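(* Let $(\mathcal H,[\cdot,\cdot])$ be a Krein space, let $B\in CR(\mathcal H)$ and $C\in L(\mathcal H)$ be such that $R(B)$ is nonnegative and $R(C)\subseteq R(B)+R(B)^{[\perp]}$. Then $X_0\in L(\mathcal H)$ is an indefinite minimum solution (ImS) of $BX-C=0$ if and only if $X_0$ is an indefinite inverse of $B$ in $R(C)$, i.e. $X_0$ is a solution of the normal equation $B^{\#}(BX-C)=0$.
   Context: A Krein space is a complex vector space $\mathcal H$ with a Hermitian sesquilinear form $[\cdot,\cdot]$ admitting a fundamental decomposition $\mathcal H=\mathcal H_+[\dotplus]\mathcal H_-$ (direct and $[\cdot,\cdot]$-orthogonal) with $(\mathcal H_+,[\cdot,\cdot])$ and $(\mathcal H_-,-[\cdot,\cdot])$ (separable) Hilbert spaces; the direct sum of these Hilbert spaces gives a Hilbert space norm on $\mathcal H$, and all such norms are equivalent. $L(\mathcal H)$ is the space of linear operators on $\mathcal H$ bounded with respect to such a norm; $CR(\mathcal H)$ is the set of those with closed range. $R(A)$, $N(A)$ are the range and null space of $A$. For $T\in L(\mathcal H)$, $T^{\#}$ is the unique operator with $[Tx,y]=[x,T^{\#}y]$ for all $x,y$. For a subspace $\mathcal S$, $\mathcal S^{[\perp]}=\{x\in\mathcal H:[x,s]=0\ \forall s\in\mathcal S\}$. $\mathcal S$ is nonnegative if $[s,s]\ge 0$ for all $s\in\mathcal S$. For $S,T\in L(\mathcal H)$, $S\le T$ means $[(T-S)x,x]\ge 0$ for all $x\in\mathcal H$. An operator $X_0\in L(\mathcal H)$ is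 an indefinite minimum solution (ImS) of $BX-C=0$ if $(BX_0-C)^{\#}(BX_0-C)\le (BX-C)^{\#}(BX-C)$ for every $X\in L(\mathcal H)$. An operator $X_0\in L(\mathcal H)$ is an indefinite inverse of $B$ in $R(C)$ if $B^{\#}(BX_0-C)=0$. *)

theory Defs
  imports "HOL-Analysis.Analysis"
begin

text \<open>A complex vector space is a type of class \<open>ab_group_add\<close> with a scalar multiplication
  satisfying the library locale \<open>vector_space\<close>. Forms are linear in the first argument and
  conjugate linear in the second. The relation \<open>z \<ge> 0\<close> for a complex number \<open>z\<close> (real and
  nonnegative) is written \<open>z \<in> \<real>\<^sub>\<ge>\<^sub>0\<close>.\<close>

definition hermitian_form ::
    "(complex \<Rightarrow> 'a::ab_group_add \<Rightarrow> 'a) \<Rightarrow> ('a \<Rightarrow> 'a \<Rightarrow> complex) \<Rightarrow> bool" where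
  "hermitian_form smul form \<longleftrightarrow>
     (\<forall>y. Vector_Spaces.linear smul (*) (\<lambda>x. form x y)) \<and>
     (\<forall>x y. form y x = cnj (form x y))"

text \<open>The modulus has no effect where the form is positive. It makes the distance nonnegative
  on the whole type, as \<open>Metric_space\<close> requires even for a distance on a proper subset.\<close>

definition form_dist :: "('a::ab_group_add \<Rightarrow> 'a \<Rightarrow> complex) \<Rightarrow> 'a \<Rightarrow> 'a \<Rightarrow> real" where
  "form_dist form x y = sqrt (cmod (form (x - y) (x - y)))"

text \<open>\<open>(M, form)\<close> is a separable Hilbert space, for a Hermitian form \<open>form\<close>.\<close>

definition hilbert_subspace ::
    "(complex \<Rightarrow> 'a::ab_group_add \<Rightarrow> 'a) \<Rightarrow> 'a set \<Rightarrow> ('a \<Rightarrow> 'a \<Rightarrow> complex) \<Rightarrow> bool" where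
  "hilbert_subspace smul M form \<longleftrightarrow>
     module.subspace smul M \<and>
     (\<forall>x\<in>M. form x x \<in> \<real>\<^sub>\<ge>\<^sub>0 \<and> (form x x = 0 \<longrightarrow> x = 0)) \<and>
     Metric_space.mcomplete M (form_dist form) \<and>
     separable_space (Metric_space.mtopology M (form_dist form))"

definition fundamental_decomposition ::
    "(complex \<Rightarrow> 'a::ab_group_add \<Rightarrow> 'a) \<Rightarrow> ('a \<Rightarrow> 'a \<Rightarrow> complex) \<Rightarrow> 'a set \<Rightarrow> 'a set \<Rightarrow> bool" where
  "fundamental_decomposition smul form P N \<longleftrightarrow>
     hilbert_subspace smul P form \<and>
     hilbert_subspace smul N (\<lambda>x y. - form x y) \<and>
     P + N = UNIV \<and> P \<inter> N = {0} \<and>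
     (\<forall>p\<in>P. \<forall>n\<in>N. form p n = 0)"

locale krein_space = vector_space smul
  for smul :: "complex \<Rightarrow> 'a::ab_group_add \<Rightarrow> 'a" +
  fixes form :: "'a \<Rightarrow> 'a \<Rightarrow> complex"
  assumes hermitian: "hermitian_form smul form"
    and fundamental_decomposition_exists: "\<exists>P N. fundamental_decomposition smul form P N"

text \<open>The norm of the Hilbert space direct sum of \<open>(P, form)\<close> and \<open>(N, - form)\<close>.\<close>

definition decomposition_norm ::
    "('a::ab_group_add \<Rightarrow> 'a \<Rightarrow> complex) \<Rightarrow> 'a set \<Rightarrow> 'a set \<Rightarrow> 'a \<Rightarrow> real" where
  "decomposition_norm form P N x =
     (let p = (THE p. p \<in> P \<and> x - p \<in> N)
      in sqrt (Re (form p p - form (x - p) (x - p))))"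

definition krein_norms ::
    "(complex \<Rightarrow> 'a::ab_group_add \<Rightarrow> 'a) \<Rightarrow> ('a \<Rightarrow> 'a \<Rightarrow> complex) \<Rightarrow> ('a \<Rightarrow> real) set" where
  "krein_norms smul form =
     {decomposition_norm form P N | P N. fundamental_decomposition smul form P N}"

text \<open>All norms in \<^term>\<open>krein_norms smul form\<close> are equivalent, so boundedness and closedness
  with respect to one of them is the same as with respect to all of them.\<close>

definition krein_L ::
    "(complex \<Rightarrow> 'a::ab_group_add \<Rightarrow> 'a) \<Rightarrow> ('a \<Rightarrow> 'a \<Rightarrow> complex) \<Rightarrow> ('a \<Rightarrow> 'a) set" where
  "krein_L smul form =
     {T. Vector_Spaces.linear smul smul T \<and>
         (\<exists>nrm \<in> krein_norms smul form. \<exists>K. \<forall>x. nrm (T x) \<le> K * nrm x)}"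

definition krein_closed ::
    "(complex \<Rightarrow> 'a::ab_group_add \<Rightarrow> 'a) \<Rightarrow> ('a \<Rightarrow> 'a \<Rightarrow> complex) \<Rightarrow> 'a set \<Rightarrow> bool" where
  "krein_closed smul form S \<longleftrightarrow>
     (\<exists>nrm \<in> krein_norms smul form.
        closedin (Metric_space.mtopology UNIV (\<lambda>x y. nrm (x - y))) S)"

definition krein_CR ::
    "(complex \<Rightarrow> 'a::ab_group_add \<Rightarrow> 'a) \<Rightarrow> ('a \<Rightarrow> 'a \<Rightarrow> complex) \<Rightarrow> ('a \<Rightarrow> 'a) set" where
  "krein_CR smul form = {T \<in> krein_L smul form. krein_closed smul form (range T)}"

definition krein_adjoint ::
    "('a \<Rightarrow> 'a \<Rightarrow> complex) \<Rightarrow> ('a \<Rightarrow> 'a) \<Rightarrow> 'a \<Rightarrow> 'a" where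
  "krein_adjoint form T = (THE S. \<forall>x y. form (T x) y = form x (S y))"

definition krein_orth :: "('a \<Rightarrow> 'a \<Rightarrow> complex) \<Rightarrow> 'a set \<Rightarrow> 'a set" where
  "krein_orth form S = {x. \<forall>s\<in>S. form x s = 0}"

definition krein_nonnegative :: "('a \<Rightarrow> 'a \<Rightarrow> complex) \<Rightarrow> 'a set \<Rightarrow> bool" where
  "krein_nonnegative form S \<longleftrightarrow> (\<forall>s\<in>S. form s s \<in> \<real>\<^sub>\<ge>\<^sub>0)"

definition krein_le ::
    "('a::ab_group_add \<Rightarrow> 'a \<Rightarrow> complex) \<Rightarrow> ('a \<Rightarrow> 'a) \<Rightarrow> ('a \<Rightarrow> 'a) \<Rightarrow> bool" where
  "krein_le form S T \<longleftrightarrow> (\<forall>x. form (T x - S x) x \<in> \<real>\<^sub>\<ge>\<^sub>0)"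

definition residual :: "('a \<Rightarrow> 'a::ab_group_add) \<Rightarrow> ('a \<Rightarrow> 'a) \<Rightarrow> ('a \<Rightarrow> 'a) \<Rightarrow> 'a \<Rightarrow> 'a" where
  "residual B C X = (\<lambda>x. B (X x) - C x)"

definition indefinite_minimum_solution ::
    "(complex \<Rightarrow> 'a::ab_group_add \<Rightarrow> 'a) \<Rightarrow> ('a \<Rightarrow> 'a \<Rightarrow> complex) \<Rightarrow>
     ('a \<Rightarrow> 'a) \<Rightarrow> ('a \<Rightarrow> 'a) \<Rightarrow> ('a \<Rightarrow> 'a) \<Rightarrow> bool" where
  "indefinite_minimum_solution smul form B C X0 \<longleftrightarrow>
     X0 \<in> krein_L smul form \<and>
     (\<forall>X \<in> krein_L smul form.
        krein_le form
          (krein_adjoint form (residual B C X0) \<circ> residual B C X0)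
          (krein_adjoint form (residual B C X) \<circ> residual B C X))"

definition indefinite_inverse ::
    "(complex \<Rightarrow> 'a::ab_group_add \<Rightarrow> 'a) \<Rightarrow> ('a \<Rightarrow> 'a \<Rightarrow> complex) \<Rightarrow>
     ('a \<Rightarrow> 'a) \<Rightarrow> ('a \<Rightarrow> 'a) \<Rightarrow> ('a \<Rightarrow> 'a) \<Rightarrow> bool" where
  "indefinite_inverse smul form B C X0 \<longleftrightarrow>
     X0 \<in> krein_L smul form \<and>
     krein_adjoint form B \<circ> residual B C X0 = (\<lambda>x. 0)"

end

theory Submission
  imports Defs
begin

text \<open>Write \<open>r = B X\<^sub>0 - C\<close>. For every competitor \<open>X\<close>, \<open>B X - C = r + B (X - X\<^sub>0)\<close>. If
  \<open>r x\<close> is orthogonal to \<open>R(B)\<close>, then \<open>[(B X - C) x, (B X - C) x]\<close> exceeds \<open>[r x, r x]\<close> by the form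
  at a vector of \<open>R(B)\<close>. Conversely, for \<open>x \<noteq> 0\<close> a rank-one perturbation of \<open>X\<^sub>0\<close> shows that
  \<open>[r x + b, r x + b] \<ge> [r x, r x]\<close> for every \<open>b\<close> in \<open>R(B)\<close>, and the first-order condition at
  \<open>b = 0\<close> is orthogonality. The adjoints exist by the Riesz theorem on the two summands of a
  fundamental decomposition.\<close>

section \<open>Hermitian forms that are positive definite on a subspace\<close>

locale definite_form = vector_space smul
  for smul :: "complex \<Rightarrow> 'a::ab_group_add \<Rightarrow> 'a" +
  fixes f :: "'a \<Rightarrow> 'a \<Rightarrow> complex" and M :: "'a set"
  assumes hermitian: "hermitian_form smul f"
    and subspace: "subspace M"
    and nonneg: "x \<in> M \<Longrightarrow> f x x \<in> \<real>\<^sub>\<ge>\<^sub>0"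
    and definite: "x \<in> M \<Longrightarrow> f x x = 0 \<Longrightarrow> x = 0"

lemma hermitian_form_commute: "hermitian_form smul f \<Longrightarrow> f y x = cnj (f x y)"
  unfolding hermitian_form_def by blast

lemma hermitian_form_algebra:
  assumes "hermitian_form smul f"
  shows "f (x + y) z = f x z + f y z" "f (smul c x) z = c * f x z"
    "f (x - y) z = f x z - f y z" "f (- x) z = - f x z" "f 0 z = 0"
    "f z (x + y) = f z x + f z y" "f z (smul c x) = cnj c * f z x"
    "f z (x - y) = f z x - f z y" "f z (- x) = - f z x" "f z 0 = 0"
proof -
  interpret l: Vector_Spaces.linear smul "(*)" "\<lambda>x. f x z" for z
    using assms unfolding hermitian_form_def by blast
  note left = l.add l.scale l.diff l.neg l.zero
  note comm = hermitian_form_commute[OF assms]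
  show "f (x + y) z = f x z + f y z" "f (smul c x) z = c * f x z"
    "f (x - y) z = f x z - f y z" "f (- x) z = - f x z" "f 0 z = 0"
    by (rule left)+
  show "f z (x + y) = f z x + f z y" "f z (smul c x) = cnj c * f z x"
    "f z (x - y) = f z x - f z y" "f z (- x) = - f z x" "f z 0 = 0"
    by (simp_all add: comm[of z] left)
qed

lemma hermitian_form_minus:
  assumes "hermitian_form smul f"
  shows "hermitian_form smul (\<lambda>x y. - f x y)"
proof -
  interpret l: Vector_Spaces.linear smul "(*)" "\<lambda>x. f x z" for z
    using assms unfolding hermitian_form_def by blast
  have "Vector_Spaces.linear smul (*) (\<lambda>x. - f x y)" for y
    by unfold_locales (simp_all add: l.add l.scale)
  moreover have "- f y x = cnj (- f x y)" for x y
    by (subst hermitian_form_commute[OF assms]) simp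
  ultimately show ?thesis
    unfolding hermitian_form_def by blast
qed

context definite_form
begin

lemmas form_algebra = hermitian_form_algebra[OF hermitian]
lemmas form_commute = hermitian_form_commute[OF hermitian]

definition len :: "'a \<Rightarrow> real" where
  "len x = sqrt (cmod (f x x))"

lemma len_nonneg: "0 \<le> len x"
  by (simp add: len_def)

lemma form_self: "x \<in> M \<Longrightarrow> f x x = of_real ((len x)\<^sup>2)"
  using nonneg[of x] by (auto simp: len_def nonneg_Reals_def)

lemma len_zero [simp]: "len 0 = 0"
  by (simp add: len_def form_algebra)

lemma len_eq_0: "x \<in> M \<Longrightarrow> len x = 0 \<longleftrightarrow> x = 0"
  using definite[of x] by (auto simp: len_def form_algebra)

lemma len_minus: "len (- x) = len x"
  by (simp add: len_def form_algebra)

lemma Cauchy_Schwarz: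
  assumes "x \<in> M" "y \<in> M"
  shows "cmod (f x y) \<le> len x * len y"
proof (cases "y = 0")
  case True
  then show ?thesis by (simp add: form_algebra len_def)
next
  case False
  \<comment> \<open>\<open>smul c y\<close> is the projection of \<open>x\<close> onto the line
    through \<open>y\<close>. The remainder \<open>z\<close> is orthogonal to \<open>y\<close>, and
    the inequality is the nonnegativity of \<open>f z z\<close>.\<close>
  define c where "c = f x y / f y y"
  define z where "z = x - smul c y"
  have "z \<in> M"
    using assms unfolding z_def by (intro subspace_diff subspace_scale subspace)
  have pos: "len y > 0"
    using False len_eq_0[OF assms(2)] len_nonneg[of y] by linarith
  have "f z z = f x x - f x y * cnj (f x y) / f y y"
    using pos form_self[OF assms(2)] form_commute[of y x]
    by (simp add: z_def c_def form_algebra field_simps power2_eq_square)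
  also have "\<dots> = of_real ((len x)\<^sup>2 - (cmod (f x y))\<^sup>2 / (len y)\<^sup>2)"
    by (simp add: form_self assms complex_norm_square[symmetric])
  finally have "of_real ((len z)\<^sup>2) = (of_real ((len x)\<^sup>2 - (cmod (f x y))\<^sup>2 / (len y)\<^sup>2) :: complex)"
    using form_self[OF \<open>z \<in> M\<close>] by simp
  then have "(len x)\<^sup>2 - (cmod (f x y))\<^sup>2 / (len y)\<^sup>2 = (len z)\<^sup>2"
    by (metis of_real_eq_iff)
  then have "(cmod (f x y))\<^sup>2 / (len y)\<^sup>2 \<le> (len x)\<^sup>2"
    by (metis diff_ge_0_iff_ge zero_le_power2)
  then have "(cmod (f x y))\<^sup>2 \<le> (len x * len y)\<^sup>2"
    using pos by (simp add: field_simps power_mult_distrib)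
  then show ?thesis
    by (rule power2_le_imp_le) (simp add: len_nonneg)
qed

lemma len_add_square:
  assumes "x \<in> M" "y \<in> M"
  shows "(len (x + y))\<^sup>2 = (len x)\<^sup>2 + 2 * Re (f x y) + (len y)\<^sup>2"
proof -
  have "Re (f (x + y) (x + y)) = Re (f x x) + 2 * Re (f x y) + Re (f y y)"
    using form_commute[of y x] by (simp add: form_algebra)
  then show ?thesis
    using assms subspace_add[OF subspace assms] by (simp add: form_self)
qed

lemma len_scale_square: "x \<in> M \<Longrightarrow> (len (smul c x))\<^sup>2 = (cmod c)\<^sup>2 * (len x)\<^sup>2"
  by (simp add: len_def form_algebra norm_mult power2_eq_square)

lemma len_triangle:
  assumes "x \<in> M" "y \<in> M"
  shows "len (x + y) \<le> len x + len y"
proof (rule power2_le_imp_le)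
  have "Re (f x y) \<le> len x * len y"
    using Cauchy_Schwarz[OF assms] complex_Re_le_cmod[of "f x y"] by linarith
  then show "(len (x + y))\<^sup>2 \<le> (len x + len y)\<^sup>2"
    by (simp add: len_add_square assms power2_sum)
qed (simp add: len_nonneg)

lemma form_dist_eq: "form_dist f x y = len (x - y)"
  by (simp add: form_dist_def len_def)

lemma Metric_space_form_dist: "Metric_space M (form_dist f)"
proof
  fix x y z
  show "0 \<le> form_dist f x y"
    by (simp add: form_dist_def)
  show "form_dist f x y = form_dist f y x"
    using len_minus[of "x - y"] by (simp add: form_dist_eq)
  show "form_dist f x y = 0 \<longleftrightarrow> x = y" if "x \<in> M" "y \<in> M"
    using len_eq_0[of "x - y"] that by (simp add: form_dist_eq subspace_diff subspace)
  show "form_dist f x z \<le> form_dist f x y + form_dist f y z" if "x \<in> M" "y \<in> M" "z \<in> M"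
    using len_triangle[of "x - y" "y - z"] that
    by (simp add: form_dist_eq subspace_diff subspace)
qed

end

section \<open>First-order conditions and the Riesz theorem\<close>

lemma quadratic_nonneg_imp_linear_zero:
  fixes a b :: real
  assumes "\<And>t. 0 \<le> 2 * t * a + t\<^sup>2 * b"
  shows "a = 0"
proof (rule ccontr)
  assume "a \<noteq> 0"
  \<comment> \<open>With \<open>t = - a / d\<close> the quadratic equals
    \<open>(a\<^sup>2 / d) * (b / d - 2)\<close>, which is negative once \<open>b < d\<close>. The
    summand 1 keeps \<open>d\<close> positive when \<open>b = 0\<close>.\<close>
  define d where "d = \<bar>b\<bar> + 1"
  have d: "d > 0" "b < d" by (simp_all add: d_def)
  have "0 \<le> 2 * (- a / d) * a + (- a / d)\<^sup>2 * b"
    by (rule assms)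
  also have "\<dots> = (a\<^sup>2 / d) * (b / d - 2)"
    using d by (simp add: field_simps power2_eq_square)
  finally have "0 \<le> (a\<^sup>2 / d) * (b / d - 2)" .
  moreover have "a\<^sup>2 / d > 0" "b / d - 2 < 0"
    using \<open>a \<noteq> 0\<close> d by (simp_all add: field_simps)
  ultimately show False
    using mult_pos_neg[of "a\<^sup>2 / d" "b / d - 2"] by linarith
qed

text \<open>Minimise \<open>len p ^ 2 - 2 Re (h p)\<close> over \<open>M\<close>: by the parallelogram identity minimising
  sequences are Cauchy, and the first-order condition at the limit is the representation.\<close>

lemma (in definite_form) Riesz_representation:
  assumes complete: "Metric_space.mcomplete M (form_dist f)"
    and h_linear: "Vector_Spaces.linear smul (*) h"
    and h_bound: "\<And>p. p \<in> M \<Longrightarrow> cmod (h p) \<le> K * len p"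
  shows "\<exists>s\<in>M. \<forall>p\<in>M. h p = f p s"
proof -
  interpret D: Metric_space M "form_dist f"
    by (rule Metric_space_form_dist)
  interpret h: Vector_Spaces.linear smul "(*)" h
    by (rule h_linear)
  define q where "q p = (len p)\<^sup>2 - 2 * Re (h p)" for p
  define m where "m = Inf (q ` M)"
  have lower: "- K\<^sup>2 \<le> q p" if "p \<in> M" for p
  proof -
    have "Re (h p) \<le> K * len p"
      using h_bound[OF that] complex_Re_le_cmod[of "h p"] by linarith
    moreover have "0 \<le> (len p)\<^sup>2 + K\<^sup>2 - 2 * (K * len p)"
      using zero_le_power2[of "len p - K"] by (simp add: power2_diff mult_ac)
    ultimately show ?thesis
      unfolding q_def by linarith
  qed
  then have bdd: "bdd_below (q ` M)"
    by (auto intro!: bdd_belowI)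
  then have m_le: "m \<le> q p" if "p \<in> M" for p
    using that unfolding m_def by (auto intro: cInf_lower)
  have "\<exists>p\<in>M. q p < m + 1 / real (Suc k)" for k
  proof -
    have "q ` M \<noteq> {}" using subspace_0[OF subspace] by blast
    moreover have "Inf (q ` M) < m + 1 / real (Suc k)" by (simp add: m_def)
    ultimately show ?thesis
      using cInf_less_iff[OF _ bdd] by blast
  qed
  then obtain u where u: "\<And>k. u k \<in> M" "\<And>k. q (u k) < m + 1 / real (Suc k)"
    by metis
  \<comment> \<open>This expansion along a real line serves twice: at \<open>t = 1/2\<close> and
    \<open>t = 1\<close> for the Cauchy estimate, and at arbitrary \<open>t\<close> for the
    first-order condition.\<close>
  have q_add: "q (x + smul (of_real t) y) = q x + 2 * t * Re (f x y - h y) + t\<^sup>2 * (len y)\<^sup>2"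
    if "x \<in> M" "y \<in> M" for x y t
    using that
    by (simp add: q_def len_add_square subspace_scale subspace len_scale_square form_algebra
        h.add h.scale algebra_simps)
  \<comment> \<open>With \<open>w = y - x\<close>, the midpoint of \<open>x\<close> and
    \<open>y\<close> lies in \<open>M\<close>, so \<open>q\<close> is at least \<open>m\<close>
    there. Eliminating the linear term between the expansions at the midpoint and at
    \<open>y\<close> leaves the bound.\<close>
  have near: "(len (x - y))\<^sup>2 \<le> 2 * (q x - m) + 2 * (q y - m)" if "x \<in> M" "y \<in> M" for x y
  proof -
    define w where "w = y - x"
    have w: "w \<in> M" "y = x + smul (of_real 1) w" "len (x - y) = len w"
      using that len_minus[of w] by (simp_all add: w_def subspace_diff subspace)
    have "m \<le> q (x + smul (of_real (1/2)) w)"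
      using that w by (intro m_le subspace_add subspace_scale subspace)
    then show ?thesis
      unfolding w(3) unfolding w(2) q_add[OF \<open>x \<in> M\<close> \<open>w \<in> M\<close>]
      by (simp add: power2_eq_square algebra_simps)
  qed
  have "D.MCauchy u"
    unfolding D.MCauchy_def
  proof (intro conjI allI impI)
    show "range u \<subseteq> M" using u by blast
    fix e :: real assume "e > 0"
    then obtain k0 where k0: "1 / real (Suc k0) < e\<^sup>2 / 4"
      using nat_approx_posE[of "e\<^sup>2 / 4"] by auto
    have "form_dist f (u i) (u j) < e" if "k0 \<le> i" "k0 \<le> j" for i j
    proof -
      have "q (u l) - m < e\<^sup>2 / 4" if "k0 \<le> l" for l
      proof -
        have "1 / real (Suc l) \<le> 1 / real (Suc k0)"
          using that by (simp add: field_simps)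
        then show ?thesis using u(2)[of l] k0 by linarith
      qed
      note bound = this
      have "(len (u i - u j))\<^sup>2 \<le> 2 * (q (u i) - m) + 2 * (q (u j) - m)"
        by (intro near u)
      also have "\<dots> < 2 * (e\<^sup>2 / 4) + 2 * (e\<^sup>2 / 4)"
        using that by (intro add_strict_mono mult_strict_left_mono bound) simp_all
      also have "\<dots> = e\<^sup>2" by simp
      finally have "(len (u i - u j))\<^sup>2 < e\<^sup>2" .
      then show ?thesis
        unfolding form_dist_eq by (rule power2_less_imp_less) (use \<open>e > 0\<close> in simp)
    qed
    then show "\<exists>N. \<forall>n n'. N \<le> n \<longrightarrow> N \<le> n' \<longrightarrow> form_dist f (u n) (u n') < e"
      by blast
  qed
  then obtain s where "limitin D.mtopology u s sequentially"
    using complete unfolding D.mcomplete_def by blast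
  then have s: "s \<in> M" and "(\<lambda>k. form_dist f (u k) s) \<longlonglongrightarrow> 0"
    by (simp_all add: D.limitin_metric_dist_null)
  then have lim: "(\<lambda>k. len (u k - s)) \<longlonglongrightarrow> 0"
    by (simp add: form_dist_eq)
  \<comment> \<open>Each \<open>u k\<close> minimises \<open>q\<close> up to
    \<open>1 / real (Suc k)\<close>. The resulting inequality in \<open>t\<close> passes to the
    limit through \<open>f (u k) p\<close> alone, without first showing that \<open>s\<close>
    attains the infimum.\<close>
  have re: "Re (f s p - h p) = 0" if "p \<in> M" for p
  proof (rule quadratic_nonneg_imp_linear_zero)
    fix t :: real
    have "(\<lambda>k. f (u k - s) p) \<longlonglongrightarrow> 0"
    proof (rule tendsto_norm_zero_cancel, rule tendsto_sandwich)
      show "\<forall>\<^sub>F k in sequentially. 0 \<le> cmod (f (u k - s) p)" by simp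
      show "\<forall>\<^sub>F k in sequentially. cmod (f (u k - s) p) \<le> len (u k - s) * len p"
        using u s that by (intro always_eventually allI Cauchy_Schwarz subspace_diff subspace)
      show "(\<lambda>k. len (u k - s) * len p) \<longlonglongrightarrow> 0"
        using tendsto_mult_right[OF lim, of "len p"] by simp
    qed simp
    then have "(\<lambda>k. f (u k) p) \<longlonglongrightarrow> f s p"
      by (simp add: form_algebra LIM_zero_iff)
    then have conv: "(\<lambda>k. 1 / real (Suc k) + 2 * t * Re (f (u k) p - h p) + t\<^sup>2 * (len p)\<^sup>2)
        \<longlonglongrightarrow> 0 + 2 * t * Re (f s p - h p) + t\<^sup>2 * (len p)\<^sup>2"
      by (intro tendsto_intros) (use LIMSEQ_inverse_real_of_nat in \<open>simp add: field_simps\<close>)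
    have ge: "0 \<le> 1 / real (Suc k) + 2 * t * Re (f (u k) p - h p) + t\<^sup>2 * (len p)\<^sup>2" for k
    proof -
      have "m \<le> q (u k + smul (of_real t) p)"
        using u that by (intro m_le subspace_add subspace_scale subspace)
      then show ?thesis
        using u(2)[of k] unfolding q_add[OF u(1) that] by linarith
    qed
    have "0 \<le> 0 + 2 * t * Re (f s p - h p) + t\<^sup>2 * (len p)\<^sup>2"
      by (rule LIMSEQ_le_const[OF conv]) (use ge in blast)
    then show "0 \<le> 2 * t * Re (f s p - h p) + t\<^sup>2 * (len p)\<^sup>2"
      by (simp only: add_0_left)
  qed
  have "h p = f p s" if "p \<in> M" for p
  proof (rule complex_eqI)
    show "Re (h p) = Re (f p s)"
      using re[OF that] form_commute[of s p] by simp
    \<comment> \<open>The real-part identity at \<open>smul \<i> p\<close> gives the imaginary part.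
      The form is conjugate linear in its second argument, which accounts for the order
      \<open>f p s\<close>.\<close>
    show "Im (h p) = Im (f p s)"
      using re[OF subspace_scale[OF subspace that, of \<i>]] form_commute[of s p]
      by (simp add: form_algebra h.scale)
  qed
  then show ?thesis using s by blast
qed

section \<open>Norm estimates and duality for a fixed fundamental decomposition\<close>

locale decomposed_krein_space = vector_space smul
  for smul :: "complex \<Rightarrow> 'a::ab_group_add \<Rightarrow> 'a" +
  fixes form :: "'a \<Rightarrow> 'a \<Rightarrow> complex" and P N :: "'a set"
  assumes hermitian: "hermitian_form smul form"
    and decomposition: "fundamental_decomposition smul form P N"
begin

sublocale pos: definite_form smul form P
  using decomposition hermitian
  by unfold_locales (auto simp: fundamental_decomposition_def hilbert_subspace_def)

text \<open>The change of sign makes the negative summand a positive definite space, so the results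
  on definite forms apply to both summands.\<close>

sublocale neg: definite_form smul "\<lambda>x y. - form x y" N
  using decomposition hermitian_form_minus[OF hermitian]
  by unfold_locales (auto simp: fundamental_decomposition_def hilbert_subspace_def)

lemmas form_algebra = pos.form_algebra
lemmas form_commute = pos.form_commute

lemma orthogonal:
  assumes "p \<in> P" "n \<in> N"
  shows "form p n = 0" "form n p = 0"
proof -
  show "form p n = 0"
    using assms decomposition unfolding fundamental_decomposition_def by blast
  then show "form n p = 0"
    using form_commute[of n p] by simp
qed

lemma decompose:
  obtains p n where "p \<in> P" "n \<in> N" "x = p + n"
proof -
  have "x \<in> P + N"
    using decomposition by (simp add: fundamental_decomposition_def)
  then show thesis using that by (auto elim: set_plus_elim)
qed

abbreviation nrm :: "'a \<Rightarrow> real" where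
  "nrm \<equiv> decomposition_norm form P N"

text \<open>Since \<open>P\<close> and \<open>N\<close> meet only in 0, the positive component of a
  vector is unique. The definite description in \<open>decomposition_norm\<close> can thus be
  evaluated from any splitting at hand.\<close>

lemma nrm_eq:
  assumes "p \<in> P" "n \<in> N"
  shows "nrm (p + n) = sqrt ((pos.len p)\<^sup>2 + (neg.len n)\<^sup>2)"
proof -
  have "(THE p'. p' \<in> P \<and> p + n - p' \<in> N) = p"
  proof (rule the_equality)
    fix p' assume p': "p' \<in> P \<and> p + n - p' \<in> N"
    then have "p - p' \<in> P" "(p + n - p') - n \<in> N"
      using assms pos.subspace neg.subspace by (blast intro: subspace_diff)+
    moreover have "(p + n - p') - n = p - p'"
      by simp
    ultimately have "p - p' \<in> P \<inter> N" by simp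
    then have "p - p' = 0"
      using decomposition unfolding fundamental_decomposition_def by blast
    then show "p' = p" by simp
  qed (use assms in simp)
  moreover have "form n n = - of_real ((neg.len n)\<^sup>2)"
    by (subst equation_minus_iff) (rule neg.form_self[OF assms(2), symmetric])
  ultimately show ?thesis
    using pos.form_self[OF assms(1)] by (simp add: decomposition_norm_def)
qed

lemma nrm_nonneg: "0 \<le> nrm x"
  by (rule decompose[of x]) (simp add: nrm_eq)

lemma len_le_nrm:
  assumes "p \<in> P" "n \<in> N"
  shows "pos.len p \<le> nrm (p + n)" "neg.len n \<le> nrm (p + n)"
  by (simp_all add: nrm_eq assms real_le_rsqrt)

lemma nrm_pos: "p \<in> P \<Longrightarrow> nrm p = pos.len p"
  using nrm_eq[of p 0] subspace_0[OF neg.subspace]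
  by (simp add: pos.len_nonneg)

lemma nrm_neg: "n \<in> N \<Longrightarrow> nrm n = neg.len n"
  using nrm_eq[of 0 n] subspace_0[OF pos.subspace]
  by (simp add: neg.len_nonneg)

text \<open>Orthogonality removes the mixed terms, and Cauchy-Schwarz applies on each summand. The
  factor 2 comes from estimating the two contributions separately; it is not sharp.\<close>

lemma form_le_nrm: "cmod (form x y) \<le> 2 * nrm x * nrm y"
proof (rule decompose[of x], rule decompose[of y])
  fix p n p' n'
  assume x: "p \<in> P" "n \<in> N" "x = p + n" and y: "p' \<in> P" "n' \<in> N" "y = p' + n'"
  have "form x y = form p p' + form n n'"
    using x y by (simp add: form_algebra orthogonal)
  then have "cmod (form x y) \<le> cmod (form p p') + cmod (form n n')"
    by (simp add: norm_triangle_ineq)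
  also have "\<dots> \<le> pos.len p * pos.len p' + neg.len n * neg.len n'"
    using pos.Cauchy_Schwarz[OF x(1) y(1)] neg.Cauchy_Schwarz[OF x(2) y(2)] by simp
  also have "\<dots> \<le> nrm x * nrm y + nrm x * nrm y"
    using x y
    by (intro add_mono mult_mono) (auto simp: len_le_nrm pos.len_nonneg neg.len_nonneg nrm_nonneg)
  finally show ?thesis by simp
qed

lemma nrm_scale: "nrm (smul c x) = cmod c * nrm x"
proof (rule decompose[of x])
  fix p n assume x: "p \<in> P" "n \<in> N" "x = p + n"
  have "smul c p \<in> P" "smul c n \<in> N"
    using x by (auto intro: subspace_scale pos.subspace neg.subspace)
  then have "nrm (smul c x) = sqrt ((cmod c)\<^sup>2 * ((pos.len p)\<^sup>2 + (neg.len n)\<^sup>2))"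
    using x by (simp add: scale_right_distrib nrm_eq pos.len_scale_square neg.len_scale_square
        distrib_left)
  then show ?thesis
    using x by (simp add: nrm_eq real_sqrt_mult)
qed

text \<open>A crude form of the triangle inequality, sufficient to show that a sum of bounded
  operators is bounded.\<close>

lemma nrm_add: "nrm (x + y) \<le> 2 * (nrm x + nrm y)"
proof (rule decompose[of x], rule decompose[of y])
  fix p n p' n'
  assume x: "p \<in> P" "n \<in> N" "x = p + n" and y: "p' \<in> P" "n' \<in> N" "y = p' + n'"
  have sum: "p + p' \<in> P" "n + n' \<in> N"
    using x y by (auto intro: subspace_add pos.subspace neg.subspace)
  have "nrm (x + y) = nrm ((p + p') + (n + n'))"
    using x y by (simp add: algebra_simps)
  also have "\<dots> \<le> pos.len (p + p') + neg.len (n + n')"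
    unfolding nrm_eq[OF sum] by (rule sqrt_sum_squares_le_sum) (simp_all add: pos.len_nonneg neg.len_nonneg)
  also have "\<dots> \<le> (pos.len p + pos.len p') + (neg.len n + neg.len n')"
    using x y by (intro add_mono pos.len_triangle neg.len_triangle)
  also have "\<dots> \<le> (nrm x + nrm y) + (nrm x + nrm y)"
    using x y by (intro add_mono) (auto simp: len_le_nrm)
  finally show ?thesis by simp
qed

text \<open>Pairing \<open>x\<close> with its own components isolates each of them by orthogonality,
  and definiteness on the summands makes both vanish.\<close>

lemma nondegenerate:
  assumes "\<And>y. form x y = 0"
  shows "x = 0"
proof (rule decompose[of x])
  fix p n assume x: "p \<in> P" "n \<in> N" "x = p + n"
  have "form p p = 0" "form n n = 0"
    using assms[of p] assms[of n] x by (simp_all add: form_algebra orthogonal)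
  then show ?thesis
    using x pos.definite[of p] neg.definite[of n] by simp
qed

text \<open>The Riesz theorem on each summand gives vectors \<open>s\<close> and \<open>t\<close>.
  As \<open>t\<close> represents with respect to \<open>- form\<close>, the vector representing
  \<open>h\<close> in the indefinite form is \<open>s - t\<close>.\<close>

lemma functional_representation:
  assumes "Vector_Spaces.linear smul (*) h" and bound: "\<And>x. cmod (h x) \<le> K * nrm x"
  shows "\<exists>s. \<forall>x. h x = form x s"
proof -
  interpret h: Vector_Spaces.linear smul "(*)" h
    by (rule assms)
  have "\<exists>s\<in>P. \<forall>p\<in>P. h p = form p s"
    using decomposition assms(1)
  proof (intro pos.Riesz_representation)
    show "cmod (h p) \<le> K * pos.len p" if "p \<in> P" for p
      using bound[of p] nrm_pos[OF that] by simp
  qed (simp_all add: fundamental_decomposition_def hilbert_subspace_def)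
  then obtain s where s: "s \<in> P" "\<And>p. p \<in> P \<Longrightarrow> h p = form p s"
    by blast
  have "\<exists>t\<in>N. \<forall>n\<in>N. h n = - form n t"
    using decomposition assms(1)
  proof (intro neg.Riesz_representation)
    show "cmod (h n) \<le> K * neg.len n" if "n \<in> N" for n
      using bound[of n] nrm_neg[OF that] by simp
  qed (simp_all add: fundamental_decomposition_def hilbert_subspace_def)
  then obtain t where t: "t \<in> N" "\<And>n. n \<in> N \<Longrightarrow> h n = - form n t"
    by blast
  have "h x = form x (s - t)" for x
  proof (rule decompose[of x])
    fix p n assume "p \<in> P" "n \<in> N" "x = p + n"
    then show ?thesis
      using s t by (simp add: form_algebra orthogonal h.add)
  qed
  then show ?thesis by blast
qed

lemma krein_LI:
  assumes "Vector_Spaces.linear smul smul T" "\<And>x. nrm (T x) \<le> K * nrm x"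
  shows "T \<in> krein_L smul form"
  using assms decomposition unfolding krein_L_def krein_norms_def by blast

end

section \<open>Existence and uniqueness of adjoints\<close>

context krein_space
begin

lemma decomposed:
  "fundamental_decomposition smul form P N \<Longrightarrow> decomposed_krein_space smul form P N"
  using hermitian by unfold_locales

lemmas form_algebra = hermitian_form_algebra[OF hermitian]
lemmas form_commute = hermitian_form_commute[OF hermitian]

lemma nondegenerate:
  assumes "\<And>y. form x y = 0"
  shows "x = 0"
proof -
  obtain P N where "fundamental_decomposition smul form P N"
    using fundamental_decomposition_exists by blast
  then interpret decomposed_krein_space smul form P N by (rule decomposed)
  show ?thesis using assms by (rule nondegenerate)
qed

lemma krein_L_linear: "T \<in> krein_L smul form \<Longrightarrow> Vector_Spaces.linear smul smul T"
  by (simp add: krein_L_def)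

lemma krein_LE:
  assumes "T \<in> krein_L smul form"
  obtains P N K where "decomposed_krein_space smul form P N"
    "\<And>x. decomposition_norm form P N (T x) \<le> K * decomposition_norm form P N x"
proof -
  obtain P N K where "fundamental_decomposition smul form P N"
    "\<forall>x. decomposition_norm form P N (T x) \<le> K * decomposition_norm form P N x"
    using assms unfolding krein_L_def krein_norms_def by blast
  then show thesis using that decomposed by blast
qed

text \<open>The decomposition is chosen so that \<open>T\<close> is bounded in its norm. For fixed
  \<open>y\<close> the functional \<open>form (T x) y\<close> of \<open>x\<close> is then bounded in
  that norm and has a representing vector, which serves as \<open>S y\<close>.\<close>

lemma ex_adjoint:
  assumes T: "T \<in> krein_L smul form"
  obtains S where "\<And>x y. form (T x) y = form x (S y)"
proof (rule krein_LE[OF T])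
  fix P N K
  assume "decomposed_krein_space smul form P N"
    and K: "\<And>x. decomposition_norm form P N (T x) \<le> K * decomposition_norm form P N x"
  then interpret D: decomposed_krein_space smul form P N by simp
  interpret T: Vector_Spaces.linear smul smul T
    using T by (rule krein_L_linear)
  interpret complex: vector_space "(*) :: complex \<Rightarrow> complex \<Rightarrow> complex"
    by unfold_locales (simp_all add: algebra_simps)
  have "\<exists>s. \<forall>x. form (T x) y = form x s" for y
  proof (rule D.functional_representation)
    show "Vector_Spaces.linear smul (*) (\<lambda>x. form (T x) y)"
      by unfold_locales (simp_all add: T.add T.scale form_algebra)
    fix x
    have "cmod (form (T x) y) \<le> 2 * D.nrm (T x) * D.nrm y"
      by (rule D.form_le_nrm)
    also have "\<dots> \<le> 2 * (K * D.nrm x) * D.nrm y"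
      using K D.nrm_nonneg by (intro mult_right_mono) auto
    finally show "cmod (form (T x) y) \<le> 2 * K * D.nrm y * D.nrm x"
      by (simp add: mult_ac)
  qed
  then obtain S where "\<And>y. \<forall>x. form (T x) y = form x (S y)"
    by metis
  then show thesis using that by blast
qed

text \<open>Nondegeneracy leaves at most one map with the adjoint identity, so the definite
  description evaluates to \<open>S\<close>.\<close>

lemma krein_adjointI:
  assumes S: "\<And>x y. form (T x) y = form x (S y)"
  shows "krein_adjoint form T = S"
  unfolding krein_adjoint_def
proof (rule the_equality)
  fix S' assume S': "\<forall>x y. form (T x) y = form x (S' y)"
  have "form (S' y - S y) x = 0" for x y
    using S[of x y] S' form_commute[of "S' y - S y" x] by (simp add: form_algebra)
  then have "S' y - S y = 0" for y
    by (rule nondegenerate)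
  then show "S' = S" by (simp add: fun_eq_iff)
qed (use S in simp)

lemma form_adjoint:
  assumes "T \<in> krein_L smul form"
  shows "form (T x) y = form x (krein_adjoint form T y)"
  using ex_adjoint[OF assms] krein_adjointI by metis

text \<open>The adjoint of the residual is assembled from those of its constituents, as these may be
  bounded with respect to different fundamental decompositions.\<close>

lemma form_residual_adjoint:
  assumes "B \<in> krein_L smul form" "C \<in> krein_L smul form" "X \<in> krein_L smul form"
  shows "form (residual B C X x) y = form x (krein_adjoint form (residual B C X) y)"
proof -
  let ?S = "\<lambda>y. krein_adjoint form X (krein_adjoint form B y) - krein_adjoint form C y"
  have eq: "form (residual B C X x) y = form x (?S y)" for x y
    by (simp add: residual_def form_algebra form_adjoint[OF assms(1)] form_adjoint[OF assms(2)]
        form_adjoint[OF assms(3)])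
  have "krein_adjoint form (residual B C X) = ?S"
    by (rule krein_adjointI) (rule eq)
  then show ?thesis by (simp only: eq)
qed

section \<open>Minimum solutions and the normal equation as pointwise conditions on the form\<close>

lemma indefinite_minimum_solution_iff:
  assumes B: "B \<in> krein_L smul form" and C: "C \<in> krein_L smul form"
    and X0: "X0 \<in> krein_L smul form"
  shows "indefinite_minimum_solution smul form B C X0 \<longleftrightarrow>
    (\<forall>X\<in>krein_L smul form. \<forall>x.
      form (residual B C X x) (residual B C X x) -
      form (residual B C X0 x) (residual B C X0 x) \<in> \<real>\<^sub>\<ge>\<^sub>0)"
proof -
  \<comment> \<open>The adjoint stands in the first argument, so the identity is used after swapping
    arguments. The conjugation this causes is harmless because \<open>form y y\<close> is
    real.\<close>
  have "form (krein_adjoint form (residual B C X) (residual B C X x)) x =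
      form (residual B C X x) (residual B C X x)" if "X \<in> krein_L smul form" for X x
    using form_residual_adjoint[OF B C that, of x "residual B C X x"]
      form_commute[of x] form_commute[of "residual B C X x" "residual B C X x"]
    by (metis complex_cnj_cnj)
  then show ?thesis
    using X0 by (simp add: indefinite_minimum_solution_def krein_le_def form_algebra)
qed

text \<open>By nondegeneracy, the null space of the adjoint of \<open>B\<close> consists of the
  vectors orthogonal to \<open>range B\<close>.\<close>

lemma indefinite_inverse_iff:
  assumes B: "B \<in> krein_L smul form" and X0: "X0 \<in> krein_L smul form"
  shows "indefinite_inverse smul form B C X0 \<longleftrightarrow>
    (\<forall>x z. form (B z) (residual B C X0 x) = 0)"
proof -
  have "krein_adjoint form B y = 0 \<longleftrightarrow> (\<forall>z. form (B z) y = 0)" for y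
  proof
    assume "\<forall>z. form (B z) y = 0"
    then have "form (krein_adjoint form B y) z = 0" for z
      using form_adjoint[OF B] form_commute by (metis complex_cnj_zero)
    then show "krein_adjoint form B y = 0" by (rule nondegenerate)
  qed (simp add: form_adjoint[OF B] form_algebra)
  then show ?thesis
    using X0 by (simp add: indefinite_inverse_def fun_eq_iff)
qed

text \<open>A rank-one perturbation moves the value at one nonzero vector arbitrarily.\<close>

lemma ex_krein_L_perturbation:
  assumes X0: "X0 \<in> krein_L smul form" and "x \<noteq> 0"
  obtains X where "X \<in> krein_L smul form" "X x = X0 x + z"
proof (rule krein_LE[OF X0])
  fix P N K
  assume "decomposed_krein_space smul form P N"
    and K: "\<And>x. decomposition_norm form P N (X0 x) \<le> K * decomposition_norm form P N x"
  then interpret D: decomposed_krein_space smul form P N by simp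
  interpret X0: Vector_Spaces.linear smul smul X0
    using X0 by (rule krein_L_linear)
  obtain w where w: "form x w \<noteq> 0"
    using nondegenerate \<open>x \<noteq> 0\<close> by blast
  \<comment> \<open>The functional \<open>form y w\<close> of \<open>y\<close> does not vanish at
    \<open>x\<close>; this scaling makes the rank-one term take the value \<open>z\<close>
    there.\<close>
  define v where "v = smul (inverse (form x w)) z"
  define X where "X y = X0 y + smul (form y w) v" for y
  have "X \<in> krein_L smul form"
  proof (rule D.krein_LI)
    show "Vector_Spaces.linear smul smul X"
      by unfold_locales
        (simp_all add: X_def X0.add X0.scale form_algebra scale_left_distrib scale_right_distrib)
    fix y
    have "D.nrm (X y) \<le> 2 * (D.nrm (X0 y) + cmod (form y w) * D.nrm v)"
      using D.nrm_add[of "X0 y" "smul (form y w) v"] by (simp add: X_def D.nrm_scale)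
    also have "\<dots> \<le> 2 * (K * D.nrm y + 2 * D.nrm y * D.nrm w * D.nrm v)"
      using K[of y] D.form_le_nrm[of y w] D.nrm_nonneg[of v]
      by (intro mult_left_mono add_mono mult_right_mono) auto
    also have "\<dots> = (2 * (K + 2 * D.nrm w * D.nrm v)) * D.nrm y"
      by (simp add: algebra_simps)
    finally show "D.nrm (X y) \<le> (2 * (K + 2 * D.nrm w * D.nrm v)) * D.nrm y" .
  qed
  moreover have "X x = X0 x + z"
    using w by (simp add: X_def v_def)
  ultimately show thesis by (rule that)
qed

lemma indefinite_minimum_solution_iff_indefinite_inverse:
  assumes B: "B \<in> krein_L smul form" and C: "C \<in> krein_L smul form"
    and nonneg: "krein_nonnegative form (range B)"
    and X0: "X0 \<in> krein_L smul form"
  shows "indefinite_minimum_solution smul form B C X0 \<longleftrightarrow> indefinite_inverse smul form B C X0"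
  unfolding indefinite_minimum_solution_iff[OF B C X0] indefinite_inverse_iff[OF B X0]
proof (intro iffI allI ballI)
  interpret B: Vector_Spaces.linear smul smul B
    using B by (rule krein_L_linear)
  interpret X0: Vector_Spaces.linear smul smul X0
    using X0 by (rule krein_L_linear)
  interpret C: Vector_Spaces.linear smul smul C
    using C by (rule krein_L_linear)
  {
    fix x z
    assume min: "\<forall>X\<in>krein_L smul form. \<forall>x.
      form (residual B C X x) (residual B C X x) -
      form (residual B C X0 x) (residual B C X0 x) \<in> \<real>\<^sub>\<ge>\<^sub>0"
    show "form (B z) (residual B C X0 x) = 0"
    \<comment> \<open>No linear perturbation moves the value at 0, but there the residual itself
      vanishes by linearity.\<close>
    proof (cases "x = 0")
      case True
      then show ?thesis
        by (simp add: residual_def X0.zero B.zero C.zero form_algebra)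
    next
      case False
      let ?r = "residual B C X0 x"
      have re: "Re (form (B z) ?r) = 0" for z
      proof (rule quadratic_nonneg_imp_linear_zero)
        fix t :: real
        obtain X where X: "X \<in> krein_L smul form" "X x = X0 x + smul (of_real t) z"
          using ex_krein_L_perturbation[OF X0 False] .
        have "residual B C X x = ?r + smul (of_real t) (B z)"
          by (simp add: residual_def X B.add B.scale)
        then have "form (?r + smul (of_real t) (B z)) (?r + smul (of_real t) (B z)) - form ?r ?r
            \<in> \<real>\<^sub>\<ge>\<^sub>0"
          using min X(1) by metis
        then show "0 \<le> 2 * t * Re (form (B z) ?r) + t\<^sup>2 * Re (form (B z) (B z))"
          using form_commute[of ?r "B z"]
          by (simp add: complex_nonneg_Reals_iff form_algebra power2_eq_square algebra_simps)
      qed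
      \<comment> \<open>Real parameters control only the real part. The instance at
        \<open>smul \<i> z\<close> supplies the imaginary part.\<close>
      show ?thesis
        using re[of z] re[of "smul \<i> z"]
        by (simp add: complex_eq_iff B.scale form_algebra)
    qed
  next
    fix X x
    assume "\<forall>x z. form (B z) (residual B C X0 x) = 0" and "X \<in> krein_L smul form"
    then have orth: "form (B z) (residual B C X0 x) = 0" for z
      by blast
    let ?r = "residual B C X0 x" and ?d = "B (X x - X0 x)"
    have "residual B C X x = ?r + ?d"
      by (simp add: residual_def B.diff)
    then have "form (residual B C X x) (residual B C X x) - form ?r ?r = form ?d ?d"
      using orth[of "X x - X0 x"] form_commute[of ?r ?d] by (simp add: form_algebra)
    then show "form (residual B C X x) (residual B C X x) - form ?r ?r \<in> \<real>\<^sub>\<ge>\<^sub>0"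
      using nonneg by (simp add: krein_nonnegative_def)
  }
qed

end

theorem corollary4p2:
  fixes smul :: "complex \<Rightarrow> 'a::ab_group_add \<Rightarrow> 'a"
    and form :: "'a \<Rightarrow> 'a \<Rightarrow> complex"
    and B C X0 :: "'a \<Rightarrow> 'a"
  assumes "krein_space smul form"
    and "B \<in> krein_CR smul form"
    and "C \<in> krein_L smul form"
    and "krein_nonnegative form (range B)"
    and "range C \<subseteq> range B + krein_orth form (range B)"
    and "X0 \<in> krein_L smul form"
  shows "indefinite_minimum_solution smul form B C X0 \<longleftrightarrow>
         indefinite_inverse smul form B C X0"
proof -
  interpret krein_space smul form by (rule assms)
  show ?thesis
    using assms
    by (intro indefinite_minimum_solution_iff_indefinite_inverse) (simp_all add: krein_CR_def)
qed

end
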